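(* For generic $\alpha,\beta,\mu\in\mathbb C$ and $w\in\mathbb C\setminus[1,\infty[$, the normalized hypergeometric function $\mathbf F^{\rm I}_{\alpha,\beta,\mu}$ satisfies the following twelve recurrence relations: $$\partial_w\mathbf F^{\rm I}_{\alpha,\beta,\mu}(w)=\tfrac{1+\alpha+\beta+\mu}{2}\mathbf F^{\rm I}_{\alpha+1,\beta+1,\mu}(w),$$ $$-\big(w(1-w)\partial_w+\alpha(1-w)-\beta w\big)\mathbf F^{\rm I}_{\alpha,\beta,\mu}(w)=\tfrac{1-\alpha-\beta+\mu}{2}\mathbf F^{\rm I}_{\alpha-1,\beta-1,\mu}(w),$$ $$\big((1-w)\partial_w-\beta\big)\mathbf F^{\rm I}_{\alpha,\beta,\mu}(w)=\tfrac{1+\alpha-\beta-\mu}{2}\mathbf F^{\rm I}_{\alpha+1,\beta-1,\mu}(w),$$ $$-\big(w\partial_w+\alpha\big)\mathbf F^{\rm I}_{\alpha,\beta,\mu}(w)=\tfrac{1-\alpha+\beta-\mu}{2}\mathbf F^{\rm I}_{\alpha-1,\beta+1,\mu}(w);$$ $$\Big(w\partial_w+\tfrac{1+\alpha+\beta+\mu}{2}\Big)\mathbf F^{\rm I}_{\alpha,\beta,\mu}(w)=\tfrac{1+\alpha+\beta+\mu}{2}\mathbf F^{\rm I}_{\alpha,\beta+1,\mu+1}(w),$$ $$-\Big(w(w-1)\partial_w+\beta+\tfrac{1+\alpha+\beta-\mu}{2}(w-1)\Big)\mathbf F^{\rm I}_{\alpha,\beta,\mu}(w)=\tfrac{1+\alpha-\beta-\mu}{2}\mathbf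 F^{\rm I}_{\alpha,\beta-1,\mu-1}(w),$$ $$-\Big(w\partial_w+\tfrac{1+\alpha+\beta-\mu}{2}\Big)\mathbf F^{\rm I}_{\alpha,\beta,\mu}(w)=\tfrac{1-\alpha+\beta-\mu}{2}\mathbf F^{\rm I}_{\alpha,\beta+1,\mu-1}(w),$$ $$\Big(w(w-1)\partial_w+\beta+\tfrac{1+\alpha+\beta+\mu}{2}(w-1)\Big)\mathbf F^{\rm I}_{\alpha,\beta,\mu}(w)=\tfrac{1-\alpha-\beta+\mu}{2}\mathbf F^{\rm I}_{\alpha,\beta-1,\mu+1}(w);$$ $$\Big((w-1)\partial_w+\tfrac{1+\alpha+\beta+\mu}{2}\Big)\mathbf F^{\rm I}_{\alpha,\beta,\mu}(w)=\tfrac{1+\alpha+\beta+\mu}{2}\mathbf F^{\rm I}_{\alpha+1,\beta,\mu+1}(w),$$ $$\Big(w(w-1)\partial_w-\alpha+\tfrac{1+\alpha+\beta-\mu}{2}w\Big)\mathbf F^{\rm I}_{\alpha,\beta,\mu}(w)=\tfrac{1-\alpha+\beta-\mu}{2}\mathbf F^{\rm I}_{\alpha-1,\beta,\mu-1}(w),$$ $$\Big((w-1)\partial_w+\tfrac{1+\alpha+\beta-\mu}{2}\Big)\mathbf F^{\rm I}_{\alpha,\beta,\mu}(w)=\tfrac{1+\alpha-\beta-\mu}{2}\mathbf F^{\rm I}_{\alpha+1,\beta,\mu-1}(w),$$ $$\Big(w(w-1)\partial_w-\alpha+\tfrac{1+\alpha+\beta+\mu}{2}w\Big)\mathbf F^{\rm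 I}_{\alpha,\beta,\mu}(w)=\tfrac{1-\alpha-\beta+\mu}{2}\mathbf F^{\rm I}_{\alpha-1,\beta,\mu+1}(w).$$
   Context: $F(a,b;c;w)=\sum_{j\ge0}\frac{(a)_j(b)_j}{(c)_j}\frac{w^j}{j!}$ for $|w|<1$, analytically continued to $\mathbb C\setminus[1,\infty[$, is the Gauss hypergeometric function. Put $$\mathbf F^{\rm I}_{\alpha,\beta,\mu}(w):=\frac{\Gamma\big(\frac{1+\alpha+\beta-\mu}{2}\big)\Gamma\big(\frac{1+\alpha-\beta+\mu}{2}\big)}{\Gamma(\alpha+1)}\,F\Big(\tfrac{1+\alpha+\beta+\mu}{2},\tfrac{1+\alpha+\beta-\mu}{2};1+\alpha;w\Big).$$ "Generic" means: $\alpha$, $\frac{1+\alpha+\beta-\mu}{2}$ and $\frac{1+\alpha-\beta+\mu}{2}$ are not integers (so that all functions occurring are well defined). *)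

theory Defs
  imports "HOL-Complex_Analysis.Complex_Analysis"
begin

definition slit_plane :: "complex set" where
  "slit_plane = - (complex_of_real ` {1..})"

definition hypergeo_series :: "complex \<Rightarrow> complex \<Rightarrow> complex \<Rightarrow> complex \<Rightarrow> complex" where
  "hypergeo_series a b c w =
     (\<Sum>j. pochhammer a j * pochhammer b j / pochhammer c j * (w ^ j / fact j))"

(* Only used when c is not a nonpositive integer; pochhammer c j is then never 0.  The slit
   plane is open and connected, so by the identity theorem any two functions eligible for the
   choice operator agree on it.  Values on the cut are unspecified. *)
definition hypergeo_F :: "complex \<Rightarrow> complex \<Rightarrow> complex \<Rightarrow> complex \<Rightarrow> complex" where
  "hypergeo_F a b c =
     (SOME f. f holomorphic_on slit_plane \<and>
              (\<forall>w. norm w < 1 \<longrightarrow> f w = hypergeo_series a b c w))"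

definition FI :: "complex \<Rightarrow> complex \<Rightarrow> complex \<Rightarrow> complex \<Rightarrow> complex" where
  "FI \<alpha> \<beta> \<mu> w =
     Gamma ((1 + \<alpha> + \<beta> - \<mu>) / 2) * Gamma ((1 + \<alpha> - \<beta> + \<mu>) / 2) / Gamma (\<alpha> + 1)
     * hypergeo_F ((1 + \<alpha> + \<beta> + \<mu>) / 2) ((1 + \<alpha> + \<beta> - \<mu>) / 2) (1 + \<alpha>) w"

definition generic :: "complex \<Rightarrow> complex \<Rightarrow> complex \<Rightarrow> bool" where
  "generic \<alpha> \<beta> \<mu> \<longleftrightarrow>
     \<alpha> \<notin> \<int> \<and> (1 + \<alpha> + \<beta> - \<mu>) / 2 \<notin> \<int> \<and> (1 + \<alpha> - \<beta> + \<mu>) / 2 \<notin> \<int>"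

end

(*
  With a = (1 + alpha + beta + mu) / 2, b = (1 + alpha + beta - mu) / 2 and c = 1 + alpha, each
  relation is a classical contiguous relation for F(a,b;c;w), rescaled by the functional equation
  of Gamma.  In the unit disc the contiguous relations are identities between Taylor coefficients,
  and the identity theorem carries them to the slit plane once F is known to extend there.

  The extension is given by Euler's integral when Re b > 1 and Re (c - b) > 1.  Its moments satisfy
  a two-term recurrence (integration by parts), so the integral is a multiple of the hypergeometric
  series; the constant is nonzero because a continuous function with vanishing moments vanishes.
  All other parameters are reached by applying to the extension the first-order operators that
  lower (b, c) and c.
*)
theory Submission
  imports Defs
begin

section \<open>Slit plane and hypergeometric power series\<close>

lemma in_slit_plane_iff: "w \<in> slit_plane \<longleftrightarrow> Im w \<noteq> 0 \<or> Re w < 1"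
proof -
  have "w \<in> complex_of_real ` {1..} \<longleftrightarrow> Im w = 0 \<and> Re w \<ge> 1"
    by (auto simp: image_iff complex_eq_iff)
  thus ?thesis by (auto simp: slit_plane_def)
qed

lemma open_slit_plane: "open slit_plane"
proof -
  have eq: "slit_plane = {w. Im w \<noteq> 0} \<union> {w. Re w < 1}"
    by (auto simp: in_slit_plane_iff)
  show ?thesis
    unfolding eq by (intro open_Un open_Collect_neq open_Collect_less continuous_intros)
qed

lemma ball_subset_slit_plane: "ball 0 1 \<subseteq> slit_plane"
proof
  fix w :: complex assume "w \<in> ball 0 1"
  thus "w \<in> slit_plane"
    using complex_Re_le_cmod[of w] by (auto simp: in_slit_plane_iff)
qed

text \<open>Star-shapedness about 0. It gives connectedness, and later keeps
  \<open>1 - of_real t * w\<close> off the branch cut of \<open>powr\<close>.\<close>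

lemma scale_in_slit_plane:
  assumes "w \<in> slit_plane" "0 \<le> t" "t \<le> 1"
  shows "of_real t * w \<in> slit_plane"
proof (cases "Im w = 0")
  case True
  hence "Re w < 1" using assms by (simp add: in_slit_plane_iff)
  have "t * Re w < 1"
  proof (cases "Re w \<le> 0")
    case True thus ?thesis using assms by (smt (verit) mult_nonneg_nonpos)
  next
    case False
    hence "t * Re w \<le> 1 * Re w" using assms by (intro mult_right_mono) auto
    thus ?thesis using \<open>Re w < 1\<close> by simp
  qed
  thus ?thesis by (simp add: in_slit_plane_iff)
qed (use assms in \<open>cases "t = 0"; auto simp: in_slit_plane_iff\<close>)

lemma connected_slit_plane: "connected slit_plane"
proof -
  have "starlike slit_plane"
    unfolding starlike_def
  proof (intro bexI ballI)
    fix w assume w: "w \<in> slit_plane"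
    show "closed_segment 0 w \<subseteq> slit_plane"
      using scale_in_slit_plane[OF w] by (auto simp: in_segment scaleR_conv_of_real)
  qed (simp add: in_slit_plane_iff)
  thus ?thesis by (rule starlike_imp_connected)
qed

section \<open>The power series and first-order operators acting on it\<close>

definition hypergeo_fps :: "complex \<Rightarrow> complex \<Rightarrow> complex \<Rightarrow> complex fps" where
  "hypergeo_fps a b c =
     Abs_fps (\<lambda>j. pochhammer a j * pochhammer b j / (pochhammer c j * fact j))"

lemma hypergeo_series_eq_eval_fps: "hypergeo_series a b c = eval_fps (hypergeo_fps a b c)"
  by (simp add: fun_eq_iff hypergeo_series_def eval_fps_def hypergeo_fps_def)

lemma hypergeo_fps_nth_Suc:
  assumes "c \<notin> \<int>\<^sub>\<le>\<^sub>0"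
  shows "fps_nth (hypergeo_fps a b c) (Suc n) =
     (a + of_nat n) * (b + of_nat n) / ((c + of_nat n) * of_nat (Suc n)) * fps_nth (hypergeo_fps a b c) n"
  by (simp add: hypergeo_fps_def pochhammer_Suc mult_ac)

text \<open>Ratio test: the quotient of consecutive coefficients tends to 1. Only a lower bound
  holds in general, since the series is a polynomial when \<open>a\<close> or \<open>b\<close> is a
  nonpositive integer.\<close>

lemma fps_conv_radius_hypergeo_fps:
  assumes c: "c \<notin> \<int>\<^sub>\<le>\<^sub>0"
  shows "fps_conv_radius (hypergeo_fps a b c) \<ge> 1"
  unfolding fps_conv_radius_def
proof (rule conv_radius_geI_ex)
  fix r :: real assume r: "0 < r" "ereal r < 1"
  let ?h = "fps_nth (hypergeo_fps a b c)"
  define q where "q n = (a + of_nat n) * (b + of_nat n) / ((c + of_nat n) * of_nat (Suc n))" for n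
  have lim: "(\<lambda>n. (x + of_nat n) / (of_nat n)) \<longlonglongrightarrow> 1" for x :: complex
  proof -
    have "(\<lambda>n. x * (1 / of_nat n) + 1) \<longlonglongrightarrow> x * 0 + 1"
      by (intro tendsto_intros lim_1_over_n)
    hence "(\<lambda>n. x * (1 / of_nat n) + 1) \<longlonglongrightarrow> 1" by simp
    moreover have "\<forall>\<^sub>F n in sequentially. x * (1 / of_nat n) + 1 = (x + of_nat n) / of_nat n"
      using eventually_gt_at_top[of 0] by eventually_elim (simp add: field_simps)
    ultimately show ?thesis by (rule Lim_transform_eventually)
  qed
  \<comment> \<open>Each linear factor is divided by \<open>n\<close>; this rewriting of
    \<open>q n\<close> is valid for \<open>n > 0\<close>.\<close>
  have "(\<lambda>n. ((a + of_nat n) / of_nat n) * ((b + of_nat n) / of_nat n) /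
            (((c + of_nat n) / of_nat n) * ((1 + of_nat n) / of_nat n))) \<longlonglongrightarrow> 1 * 1 / (1 * 1)"
    by (intro tendsto_intros lim) auto
  hence "(\<lambda>n. ((a + of_nat n) / of_nat n) * ((b + of_nat n) / of_nat n) /
            (((c + of_nat n) / of_nat n) * ((1 + of_nat n) / of_nat n))) \<longlonglongrightarrow> 1" by simp
  moreover have "\<forall>\<^sub>F n in sequentially. ((a + of_nat n) / of_nat n) * ((b + of_nat n) / of_nat n) /
            (((c + of_nat n) / of_nat n) * ((1 + of_nat n) / of_nat n)) = q n"
    using eventually_gt_at_top[of 0] by eventually_elim (simp add: q_def)
  ultimately have "q \<longlonglongrightarrow> 1" by (rule Lim_transform_eventually)
  hence "(\<lambda>n. norm (q n) * r) \<longlonglongrightarrow> norm (1::complex) * r" by (intro tendsto_intros)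
  moreover obtain s where s: "r < s" "s < 1" using r dense[of r 1] by auto
  ultimately have "\<forall>\<^sub>F n in sequentially. norm (q n) * r < s"
    by (intro order_tendstoD(2)) auto
  then obtain N where N: "\<And>n. n \<ge> N \<Longrightarrow> norm (q n) * r < s"
    by (auto simp: eventually_sequentially)
  have "summable (\<lambda>n. ?h n * of_real r ^ n)"
  proof (rule summable_ratio_test[OF s(2)])
    fix n assume "n \<ge> N"
    have "norm (?h (Suc n) * of_real r ^ Suc n) = (norm (q n) * r) * norm (?h n * of_real r ^ n)"
      unfolding hypergeo_fps_nth_Suc[OF c] q_def[symmetric] using r
      by (simp add: norm_mult norm_power)
    also have "\<dots> \<le> s * norm (?h n * of_real r ^ n)"
      using N[OF \<open>n \<ge> N\<close>] by (intro mult_right_mono) auto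
    finally show "norm (?h (Suc n) * of_real r ^ Suc n) \<le> s * norm (?h n * of_real r ^ n)" .
  qed
  thus "\<exists>z. norm z = r \<and> summable (\<lambda>n. ?h n * z ^ n)"
    using r by (intro exI[of _ "of_real r"]) auto
qed

text \<open>All operators used below have a polynomial of degree at most 2 before the derivative and
  of degree at most 1 before the function, so at most three neighbouring coefficients
  interact.\<close>

lemma fps_nth_second_order_operator:
  fixes f :: "complex fps"
  shows "fps_nth ((fps_const p0 + fps_X * (fps_const p1 + fps_X * fps_const p2)) * fps_deriv f
           + (fps_const q0 + fps_X * fps_const q1) * f) n
       = p0 * of_nat (Suc n) * fps_nth f (Suc n) + (p1 * of_nat n + q0) * fps_nth f n
         + (case n of 0 \<Rightarrow> 0 | Suc m \<Rightarrow> (p2 * of_nat m + q1) * fps_nth f m)"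
  by (cases n; cases "n - 1") (auto simp: algebra_simps)

text \<open>Comparison of Taylor coefficients. \<open>rel0\<close> is index 0, where the first two
  coefficients of the series are 1 and \<open>a * b / c\<close>; \<open>rel\<close> covers the
  positive indices.\<close>

lemma hypergeo_series_relation:
  assumes c: "c \<notin> \<int>\<^sub>\<le>\<^sub>0" "c' \<notin> \<int>\<^sub>\<le>\<^sub>0" and w: "norm w < 1"
  assumes rel0: "p0 * (a * b / c) + q0 = k"
  assumes rel: "\<And>n. p0 * of_nat (Suc (Suc n)) * fps_nth (hypergeo_fps a b c) (Suc (Suc n))
             + (p1 * of_nat (Suc n) + q0) * fps_nth (hypergeo_fps a b c) (Suc n)
             + (p2 * of_nat n + q1) * fps_nth (hypergeo_fps a b c) n
             = k * fps_nth (hypergeo_fps a' b' c') (Suc n)"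
  shows "(p0 + w * (p1 + w * p2)) * deriv (hypergeo_series a b c) w
          + (q0 + w * q1) * hypergeo_series a b c w = k * hypergeo_series a' b' c' w"
proof -
  let ?h = "hypergeo_fps a b c" and ?h' = "hypergeo_fps a' b' c'"
  let ?P = "fps_const p0 + fps_X * (fps_const p1 + fps_X * fps_const p2)"
  let ?Q = "fps_const q0 + fps_X * fps_const q1"
  have eq: "?P * fps_deriv ?h + ?Q * ?h = fps_const k * ?h'"
  proof (rule fps_ext)
    fix n show "fps_nth (?P * fps_deriv ?h + ?Q * ?h) n = fps_nth (fps_const k * ?h') n"
    proof (cases n)
      case 0
      thus ?thesis using rel0
        unfolding fps_nth_second_order_operator by (simp add: hypergeo_fps_def)
    next
      case (Suc m)
      thus ?thesis using rel[of m] unfolding fps_nth_second_order_operator by simp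
    qed
  qed
  have 1: "fps_conv_radius ?h > norm w" "fps_conv_radius ?h' > norm w"
    using fps_conv_radius_hypergeo_fps[of c a b] fps_conv_radius_hypergeo_fps[of c' a' b'] c w
    by (meson ereal_less(3) less_le_trans)+
  have 2: "fps_conv_radius (fps_deriv ?h) > norm w"
    using 1(1) fps_conv_radius_deriv[of ?h] by (rule less_le_trans)
  have poly: "fps_conv_radius (fps_const x + fps_X * f) = \<infinity>"
    if "fps_conv_radius f = \<infinity>" for x and f :: "complex fps"
    using fps_conv_radius_add[of "fps_const x" "fps_X * f"] fps_conv_radius_mult[of fps_X f] that
    by simp
  have 3: "fps_conv_radius (fps_const p1 + fps_X * fps_const p2) = \<infinity>" by (simp add: poly)
  have 4: "fps_conv_radius ?P = \<infinity>" by (simp add: poly)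
  have 5: "fps_conv_radius ?Q = \<infinity>" by (simp add: poly)
  have X: "fps_conv_radius (fps_X * f) > norm w" if "fps_conv_radius f > norm w" for f :: "complex fps"
    using fps_conv_radius_mult[of fps_X f] that by (auto intro: less_le_trans)
  have m: "fps_conv_radius (f * g) > norm w"
    if "fps_conv_radius f > norm w" "fps_conv_radius g > norm w"
    for f g :: "complex fps"
    using fps_conv_radius_mult[of f g] that by (meson less_le_trans min_less_iff_conj)
  have "eval_fps (?P * fps_deriv ?h + ?Q * ?h) w
      = (p0 + w * (p1 + w * p2)) * deriv (eval_fps ?h) w + (q0 + w * q1) * eval_fps ?h w"
    using 1 2 3 4 5
    by (simp add: eval_fps_add eval_fps_mult m X eval_fps_deriv)
  moreover have "eval_fps (fps_const k * ?h') w = k * eval_fps ?h' w"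
    using 1 by (simp add: eval_fps_mult)
  ultimately show ?thesis using eq by (simp add: hypergeo_series_eq_eval_fps)
qed

section \<open>Continuations of the series to the slit plane\<close>

definition is_hypergeo_continuation ::
    "complex \<Rightarrow> complex \<Rightarrow> complex \<Rightarrow> (complex \<Rightarrow> complex) \<Rightarrow> bool" where
  "is_hypergeo_continuation a b c f \<longleftrightarrow> f holomorphic_on slit_plane \<and>
     (\<forall>w. norm w < 1 \<longrightarrow> f w = hypergeo_series a b c w)"

lemma deriv_hypergeo_continuation:
  assumes "is_hypergeo_continuation a b c f" "norm w < 1"
  shows "deriv f w = deriv (hypergeo_series a b c) w"
proof (rule deriv_cong_ev)
  have "\<forall>\<^sub>F z in nhds w. z \<in> ball 0 1"
    using assms by (intro eventually_nhds_in_open) auto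
  thus "\<forall>\<^sub>F z in nhds w. f z = hypergeo_series a b c z"
    by eventually_elim (use assms in \<open>auto simp: is_hypergeo_continuation_def\<close>)
qed auto

text \<open>Both sides are holomorphic on the connected slit plane and agree on the unit disc, so
  the identity theorem applies.\<close>

lemma hypergeo_relation_continuation:
  assumes f: "is_hypergeo_continuation a b c f"
  assumes g: "is_hypergeo_continuation a' b' c' g"
  assumes rel: "\<And>w. norm w < 1 \<Longrightarrow>
    (p0 + w * (p1 + w * p2)) * deriv (hypergeo_series a b c) w
          + (q0 + w * q1) * hypergeo_series a b c w = k * hypergeo_series a' b' c' w"
  assumes w: "w \<in> slit_plane"
  shows "(p0 + w * (p1 + w * p2)) * deriv f w + (q0 + w * q1) * f w = k * g w"
proof (rule analytic_continuation_open[where s = "ball 0 1" and s' = slit_plane and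
        f = "\<lambda>w. (p0 + w * (p1 + w * p2)) * deriv f w + (q0 + w * q1) * f w" and g = "\<lambda>w. k * g w"])
  show "(\<lambda>w. (p0 + w * (p1 + w * p2)) * deriv f w + (q0 + w * q1) * f w) holomorphic_on slit_plane"
    using f open_slit_plane
    by (intro holomorphic_intros) (auto simp: is_hypergeo_continuation_def)
  show "(\<lambda>w. k * g w) holomorphic_on slit_plane"
    using g by (intro holomorphic_intros) (auto simp: is_hypergeo_continuation_def)
  show "(p0 + z * (p1 + z * p2)) * deriv f z + (q0 + z * q1) * f z = k * g z" if "z \<in> ball 0 1" for z
    using rel[of z] that f g deriv_hypergeo_continuation[OF f, of z]
    by (auto simp: is_hypergeo_continuation_def)
qed (use w open_slit_plane connected_slit_plane ball_subset_slit_plane in auto)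

text \<open>Here a relation serves as a construction: the operator applied to a known continuation,
  divided by \<open>k\<close>, continues the series with the new parameters.\<close>

lemma hypergeo_continuation_lower:
  assumes f: "is_hypergeo_continuation a b c f" and "k \<noteq> 0"
  assumes rel: "\<And>w. norm w < 1 \<Longrightarrow>
    (p0 + w * (p1 + w * p2)) * deriv (hypergeo_series a b c) w
          + (q0 + w * q1) * hypergeo_series a b c w = k * hypergeo_series a' b' c' w"
  shows "\<exists>g. is_hypergeo_continuation a' b' c' g"
proof
  let ?g = "\<lambda>w. ((p0 + w * (p1 + w * p2)) * deriv f w + (q0 + w * q1) * f w) / k"
  have "?g holomorphic_on slit_plane"
    using f open_slit_plane \<open>k \<noteq> 0\<close>
    by (intro holomorphic_intros) (auto simp: is_hypergeo_continuation_def)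
  thus "is_hypergeo_continuation a' b' c' ?g"
    using f rel deriv_hypergeo_continuation[OF f] \<open>k \<noteq> 0\<close>
    by (auto simp: is_hypergeo_continuation_def)
qed

section \<open>Contiguous relations in the unit disc\<close>

lemma add_of_nat_nonzero: "c \<notin> \<int>\<^sub>\<le>\<^sub>0 \<Longrightarrow> c + of_nat n \<noteq> (0 :: complex)"
  using plus_of_nat_eq_0_imp by blast

text \<open>Both sides equal \<open>pochhammer a (Suc n)\<close>. The product form also covers
  \<open>a = 0\<close>.\<close>

lemma pochhammer_plus1: "a * pochhammer (a + 1) n = (a + of_nat n) * pochhammer a n"
  for a :: complex
  using pochhammer_rec[of a n] pochhammer_rec'[of a n] by simp

lemma pochhammer_plus1': "c \<notin> \<int>\<^sub>\<le>\<^sub>0 \<Longrightarrow> pochhammer (c + 1) n = (c + of_nat n) * pochhammer c n / c"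
  for c :: complex
  using pochhammer_plus1[of c n] add_of_nat_nonzero[of c 0] by (simp add: field_simps)

lemma pochhammer_nonzero: "c \<notin> \<int>\<^sub>\<le>\<^sub>0 \<Longrightarrow> pochhammer c n \<noteq> 0"
  for c :: complex
  by (metis pochhammer_eq_0_iff minus_of_nat_in_nonpos_Ints)

lemma pochhammer_minus1: "pochhammer (a - 1) (Suc n) = (a - 1) * pochhammer a n"
  for a :: complex
  by (simp add: pochhammer_rec)

lemma notin_nonpos_Ints_minus1: "z - 1 \<notin> \<int>\<^sub>\<le>\<^sub>0 \<Longrightarrow> z \<notin> \<int>\<^sub>\<le>\<^sub>0 \<and> z \<noteq> 1"
  for z :: complex
  using plus_one_in_nonpos_Ints_imp[of "z - 1"] by auto

lemma notin_nonpos_Ints_plus1: "z \<notin> \<int>\<^sub>\<le>\<^sub>0 \<Longrightarrow> z + 1 \<notin> \<int>\<^sub>\<le>\<^sub>0"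
  for z :: complex
  using plus_one_in_nonpos_Ints_imp by blast

lemma hypergeo_denominators_nonzero:
  fixes c :: complex
  assumes "c \<notin> \<int>\<^sub>\<le>\<^sub>0"
  shows "pochhammer c n \<noteq> 0" "c + of_nat n \<noteq> 0" "c + of_nat (Suc n) \<noteq> 0"
    "(of_nat (Suc n) :: complex) \<noteq> 0" "(of_nat (Suc (Suc n)) :: complex) \<noteq> 0"
    "(fact n :: complex) \<noteq> 0"
  by (intro pochhammer_nonzero add_of_nat_nonzero assms of_nat_neq_0 fact_nonzero)+

text \<open>The zero coefficients in the statements below keep every relation in the shape of
  \<open>hypergeo_series_relation\<close>, so that it can be passed to the transfer rules by
  unification.\<close>

lemma hypergeo_series_a_b_c_plus:
  assumes "c \<notin> \<int>\<^sub>\<le>\<^sub>0" "norm w < 1"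
  shows "(1 + w * (0 + w * 0)) * deriv (hypergeo_series a b c) w
          + (0 + w * 0) * hypergeo_series a b c w
       = a * b / c * hypergeo_series (a + 1) (b + 1) (c + 1) w"
proof (rule hypergeo_series_relation)
  fix n
  have c: "c \<notin> \<int>\<^sub>\<le>\<^sub>0" "c \<noteq> 0" using assms by auto
  show "1 * of_nat (Suc (Suc n)) * fps_nth (hypergeo_fps a b c) (Suc (Suc n))
             + (0 * of_nat (Suc n) + 0) * fps_nth (hypergeo_fps a b c) (Suc n)
             + (0 * of_nat n + 0) * fps_nth (hypergeo_fps a b c) n
             = (a * b / c) * fps_nth (hypergeo_fps (a + 1) (b + 1) (c + 1)) (Suc n)"
    \<comment> \<open>Clearing denominators leaves a polynomial identity. The symbols at
      \<open>a + 1\<close> and \<open>b + 1\<close> enter through \<open>pochhammer_plus1\<close>,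
      without division, because \<open>a\<close> or \<open>b\<close> may vanish.\<close>
    using c(2) hypergeo_denominators_nonzero[OF c(1), of n]
    unfolding hypergeo_fps_def fps_nth_Abs_fps pochhammer_plus1'[OF c(1)]
      pochhammer_rec' fact_Suc of_nat_Suc
    by (simp add: divide_simps)
      (use pochhammer_plus1[of a n] pochhammer_plus1[of b n] in algebra)
qed (use assms notin_nonpos_Ints_minus1 notin_nonpos_Ints_plus1 in \<open>auto simp: field_simps\<close>)

lemma hypergeo_series_a_b_c_minus:
  assumes "c - 1 \<notin> \<int>\<^sub>\<le>\<^sub>0" "norm w < 1"
  shows "(0 + w * (1 + w * (-1))) * deriv (hypergeo_series a b c) w
          + (c - 1 + w * (-(a + b - 1))) * hypergeo_series a b c w
       = (c - 1) * hypergeo_series (a - 1) (b - 1) (c - 1) w"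
proof (rule hypergeo_series_relation)
  fix n
  have c: "c \<notin> \<int>\<^sub>\<le>\<^sub>0" "c - 1 \<noteq> 0" using notin_nonpos_Ints_minus1 assms by auto
  show "0 * of_nat (Suc (Suc n)) * fps_nth (hypergeo_fps a b c) (Suc (Suc n))
             + (1 * of_nat (Suc n) + (c - 1)) * fps_nth (hypergeo_fps a b c) (Suc n)
             + ((-1) * of_nat n + (-(a + b - 1))) * fps_nth (hypergeo_fps a b c) n
             = (c - 1) * fps_nth (hypergeo_fps (a - 1) (b - 1) (c - 1)) (Suc n)"
    using c(2) hypergeo_denominators_nonzero[OF c(1), of n]
    \<comment> \<open>The symbols at \<open>a - 1\<close>, \<open>b - 1\<close>,
      \<open>c - 1\<close> have to be reduced to \<open>a\<close>, \<open>b\<close>,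
      \<open>c\<close> before \<open>pochhammer_rec'\<close> takes apart the remaining ones of index
      \<open>Suc n\<close>.\<close>
    unfolding hypergeo_fps_def fps_nth_Abs_fps pochhammer_minus1
    unfolding pochhammer_rec' fact_Suc of_nat_Suc
    by (simp add: divide_simps) algebra
qed (use assms notin_nonpos_Ints_minus1 notin_nonpos_Ints_plus1 in \<open>auto simp: field_simps\<close>)

text \<open>Up to the denominator \<open>c + n\<close>, the n-th coefficient is multiplied by
  \<open>(a + n) * (b + n) - (n + a + b - c) * (c + n)\<close>. The powers of \<open>n\<close>
  cancel and \<open>(c - a) * (c - b)\<close> remains.\<close>

lemma hypergeo_series_c_plus:
  assumes "c \<notin> \<int>\<^sub>\<le>\<^sub>0" "norm w < 1"
  shows "(1 + w * (-1 + w * 0)) * deriv (hypergeo_series a b c) w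
          + (-(a + b - c) + w * 0) * hypergeo_series a b c w
       = (c - a) * (c - b) / c * hypergeo_series a b (c + 1) w"
proof (rule hypergeo_series_relation)
  fix n
  have c: "c \<notin> \<int>\<^sub>\<le>\<^sub>0" "c \<noteq> 0" using assms by auto
  show "1 * of_nat (Suc (Suc n)) * fps_nth (hypergeo_fps a b c) (Suc (Suc n))
             + ((-1) * of_nat (Suc n) + (-(a + b - c))) * fps_nth (hypergeo_fps a b c) (Suc n)
             + (0 * of_nat n + 0) * fps_nth (hypergeo_fps a b c) n
             = ((c - a) * (c - b) / c) * fps_nth (hypergeo_fps a b (c + 1)) (Suc n)"
    using c(2) hypergeo_denominators_nonzero[OF c(1), of n]
    unfolding hypergeo_fps_def fps_nth_Abs_fps pochhammer_plus1'[OF c(1)]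
      pochhammer_rec' fact_Suc of_nat_Suc
    by (simp add: divide_simps) algebra
next
  have "c \<noteq> 0" using assms by auto
  thus "1 * (a * b / c) + - (a + b - c) = (c - a) * (c - b) / c"
    by (simp add: field_simps)
qed (use assms notin_nonpos_Ints_plus1 in auto)

text \<open>The operator multiplies the n-th coefficient by \<open>c - 1 + n\<close>, which turns
  \<open>pochhammer c n\<close> in the denominator into \<open>pochhammer (c - 1) n\<close> up to
  the factor \<open>c - 1\<close>.\<close>

lemma hypergeo_series_c_minus:
  assumes "c - 1 \<notin> \<int>\<^sub>\<le>\<^sub>0" "norm w < 1"
  shows "(0 + w * (1 + w * 0)) * deriv (hypergeo_series a b c) w
          + (c - 1 + w * 0) * hypergeo_series a b c w
       = (c - 1) * hypergeo_series a b (c - 1) w"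
proof (rule hypergeo_series_relation)
  fix n
  have c: "c \<notin> \<int>\<^sub>\<le>\<^sub>0" "c - 1 \<noteq> 0" using notin_nonpos_Ints_minus1 assms by auto
  show "0 * of_nat (Suc (Suc n)) * fps_nth (hypergeo_fps a b c) (Suc (Suc n))
             + (1 * of_nat (Suc n) + (c - 1)) * fps_nth (hypergeo_fps a b c) (Suc n)
             + (0 * of_nat n + 0) * fps_nth (hypergeo_fps a b c) n
             = (c - 1) * fps_nth (hypergeo_fps a b (c - 1)) (Suc n)"
    using c(2) hypergeo_denominators_nonzero[OF c(1), of n]
    unfolding hypergeo_fps_def fps_nth_Abs_fps pochhammer_minus1
    unfolding pochhammer_rec' fact_Suc of_nat_Suc
    by (simp add: divide_simps)
qed (use assms notin_nonpos_Ints_minus1 notin_nonpos_Ints_plus1 in \<open>auto simp: field_simps\<close>)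

lemma hypergeo_series_a_plus:
  assumes "c \<notin> \<int>\<^sub>\<le>\<^sub>0" "norm w < 1"
  shows "(0 + w * (1 + w * 0)) * deriv (hypergeo_series a b c) w
          + (a + w * 0) * hypergeo_series a b c w
       = a * hypergeo_series (a + 1) b c w"
proof (rule hypergeo_series_relation)
  fix n
  have c: "c \<notin> \<int>\<^sub>\<le>\<^sub>0" "c \<noteq> 0" using assms by auto
  show "0 * of_nat (Suc (Suc n)) * fps_nth (hypergeo_fps a b c) (Suc (Suc n))
             + (1 * of_nat (Suc n) + a) * fps_nth (hypergeo_fps a b c) (Suc n)
             + (0 * of_nat n + 0) * fps_nth (hypergeo_fps a b c) n
             = a * fps_nth (hypergeo_fps (a + 1) b c) (Suc n)"
    using c(2) hypergeo_denominators_nonzero[OF c(1), of n]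
    unfolding hypergeo_fps_def fps_nth_Abs_fps pochhammer_plus1'[OF c(1)]
      pochhammer_rec' fact_Suc of_nat_Suc
    by (simp add: divide_simps, (intro disjI2)?)
      (use pochhammer_plus1[of a n] pochhammer_plus1[of b n] in algebra)
qed (use assms notin_nonpos_Ints_minus1 notin_nonpos_Ints_plus1 in \<open>auto simp: field_simps\<close>)

text \<open>At index \<open>n > 0\<close>, once the common factors are taken out, this is the
  identity \<open>(n + c - a) * (a + n - 1) - n * (c + n - 1) = (c - a) * (a - 1)\<close>.\<close>

lemma hypergeo_series_a_minus:
  assumes "c \<notin> \<int>\<^sub>\<le>\<^sub>0" "norm w < 1"
  shows "(0 + w * (1 + w * (-1))) * deriv (hypergeo_series a b c) w
          + (c - a + w * (-b)) * hypergeo_series a b c w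
       = (c - a) * hypergeo_series (a - 1) b c w"
proof (rule hypergeo_series_relation)
  fix n
  have c: "c \<notin> \<int>\<^sub>\<le>\<^sub>0" "c \<noteq> 0" using assms by auto
  show "0 * of_nat (Suc (Suc n)) * fps_nth (hypergeo_fps a b c) (Suc (Suc n))
             + (1 * of_nat (Suc n) + (c - a)) * fps_nth (hypergeo_fps a b c) (Suc n)
             + ((-1) * of_nat n + (-b)) * fps_nth (hypergeo_fps a b c) n
             = (c - a) * fps_nth (hypergeo_fps (a - 1) b c) (Suc n)"
    using c(2) hypergeo_denominators_nonzero[OF c(1), of n]
    unfolding hypergeo_fps_def fps_nth_Abs_fps pochhammer_minus1
    unfolding pochhammer_rec' fact_Suc of_nat_Suc
    by (simp add: divide_simps) algebra
qed (use assms notin_nonpos_Ints_minus1 notin_nonpos_Ints_plus1 in \<open>auto simp: field_simps\<close>)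

text \<open>Here \<open>(a + n) * (b + n) - (n + a) * (c + n) = (a + n) * (b - c)\<close>, and the
  factor \<open>a + n\<close> raises \<open>a\<close> by \<open>pochhammer_plus1\<close>.\<close>

lemma hypergeo_series_a_c_plus:
  assumes "c \<notin> \<int>\<^sub>\<le>\<^sub>0" "norm w < 1"
  shows "(1 + w * (-1 + w * 0)) * deriv (hypergeo_series a b c) w
          + (-a + w * 0) * hypergeo_series a b c w
       = -(a * (c - b) / c) * hypergeo_series (a + 1) b (c + 1) w"
proof (rule hypergeo_series_relation)
  fix n
  have c: "c \<notin> \<int>\<^sub>\<le>\<^sub>0" "c \<noteq> 0" using assms by auto
  show "1 * of_nat (Suc (Suc n)) * fps_nth (hypergeo_fps a b c) (Suc (Suc n))
             + ((-1) * of_nat (Suc n) + (-a)) * fps_nth (hypergeo_fps a b c) (Suc n)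
             + (0 * of_nat n + 0) * fps_nth (hypergeo_fps a b c) n
             = (-(a * (c - b) / c)) * fps_nth (hypergeo_fps (a + 1) b (c + 1)) (Suc n)"
    using c(2) hypergeo_denominators_nonzero[OF c(1), of n]
    unfolding hypergeo_fps_def fps_nth_Abs_fps pochhammer_plus1'[OF c(1)]
      pochhammer_rec' fact_Suc of_nat_Suc
    by (simp add: divide_simps)
      (use pochhammer_plus1[of a n] pochhammer_plus1[of b n] in algebra)
next
  have "c \<noteq> 0" using assms by auto
  thus "1 * (a * b / c) + - a = - (a * (c - b) / c)"
    by (simp add: field_simps)
qed (use assms notin_nonpos_Ints_plus1 in auto)

text \<open>With \<open>a\<close> and \<open>b\<close> exchanged, this is also the operator that
  lowers \<open>(b, c)\<close> in the extension argument.\<close>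

lemma hypergeo_series_a_c_minus:
  assumes "c - 1 \<notin> \<int>\<^sub>\<le>\<^sub>0" "norm w < 1"
  shows "(0 + w * (1 + w * (-1))) * deriv (hypergeo_series a b c) w
          + (c - 1 + w * (-b)) * hypergeo_series a b c w
       = (c - 1) * hypergeo_series (a - 1) b (c - 1) w"
proof (rule hypergeo_series_relation)
  fix n
  have c: "c \<notin> \<int>\<^sub>\<le>\<^sub>0" "c - 1 \<noteq> 0" using notin_nonpos_Ints_minus1 assms by auto
  show "0 * of_nat (Suc (Suc n)) * fps_nth (hypergeo_fps a b c) (Suc (Suc n))
             + (1 * of_nat (Suc n) + (c - 1)) * fps_nth (hypergeo_fps a b c) (Suc n)
             + ((-1) * of_nat n + (-b)) * fps_nth (hypergeo_fps a b c) n
             = (c - 1) * fps_nth (hypergeo_fps (a - 1) b (c - 1)) (Suc n)"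
    using c(2) hypergeo_denominators_nonzero[OF c(1), of n]
    unfolding hypergeo_fps_def fps_nth_Abs_fps pochhammer_minus1
    unfolding pochhammer_rec' fact_Suc of_nat_Suc
    by (simp add: divide_simps) algebra
qed (use assms notin_nonpos_Ints_minus1 notin_nonpos_Ints_plus1 in \<open>auto simp: field_simps\<close>)

section \<open>Analytic continuation by the Euler integral\<close>

text \<open>Integrals of \<open>f\<close> against polynomials vanish, and \<open>f\<close> is
  uniformly close to a polynomial by Weierstrass, so the integral of the square of \<open>f\<close>
  is below every positive bound.\<close>

lemma moments_eq_0_imp_eq_0:
  fixes f :: "real \<Rightarrow> real"
  assumes cont: "continuous_on {0..1} f"
    and moments: "\<And>n. integral {0..1} (\<lambda>t. t ^ n * f t) = 0"
    and t: "t \<in> {0..1}"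
  shows "f t = 0"
proof -
  have int: "(\<lambda>t. p t * f t) integrable_on {0..1}" if "continuous_on {0..1} p" for p
    using that cont by (intro integrable_continuous_interval continuous_intros)
  have poly: "integral {0..1} (\<lambda>t. p t * f t) = 0" if p: "real_polynomial_function p" for p
  proof -
    obtain a and n :: nat where p_eq: "p = (\<lambda>x. \<Sum>i\<le>n. a i * x ^ i)"
      using real_polynomial_function_imp_sum[OF p] by blast
    have "integral {0..1} (\<lambda>t. p t * f t) = integral {0..1} (\<lambda>t. \<Sum>i\<le>n. a i * (t ^ i * f t))"
      by (simp add: p_eq sum_distrib_right mult.assoc)
    also have "\<dots> = (\<Sum>i\<le>n. integral {0..1} (\<lambda>t. a i * (t ^ i * f t)))"
      by (intro integral_sum integrable_on_mult_right int continuous_intros) auto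
    also have "\<dots> = 0" by (simp add: moments)
    finally show ?thesis .
  qed
  obtain B where B: "\<And>x. x \<in> {0..1} \<Longrightarrow> norm (f x) \<le> B"
    using compact_continuous_image[OF cont]
    by (metis compact_Icc compact_imp_bounded bounded_iff imageI)
  have B0: "B \<ge> 0" using B[of 0] by (smt (verit) atLeastAtMost_iff norm_ge_zero)
  have "integral {0..1} (\<lambda>t. f t * f t) \<le> e" if "e > 0" for e
  proof -
    \<comment> \<open>\<open>B + 1\<close> keeps the quotient defined when
      \<open>B = 0\<close>.\<close>
    define d where "d = e / (B + 1)"
    have d: "d > 0" "d * B \<le> e" using that B0 by (auto simp: d_def field_simps)
    obtain p where p: "real_polynomial_function p" "\<And>x. x \<in> {0..1} \<Longrightarrow> \<bar>f x - p x\<bar> < d"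
      using Stone_Weierstrass_real_polynomial_function[OF compact_Icc cont d(1)] by blast
    have pc: "continuous_on {0..1} p"
      using p(1) by (simp add: continuous_on_polymonial_function real_polynomial_function_eq)
    have "integral {0..1} (\<lambda>t. f t * f t)
        = integral {0..1} (\<lambda>t. f t * f t) - integral {0..1} (\<lambda>t. p t * f t)"
      using poly[OF p(1)] by simp
    also have "\<dots> = integral {0..1} (\<lambda>t. f t * f t - p t * f t)"
      by (intro integral_diff [symmetric] int cont pc)
    also have "\<dots> = integral {0..1} (\<lambda>t. (f t - p t) * f t)" by (simp add: algebra_simps)
    also have "\<dots> \<le> integral {0..1} (\<lambda>t::real. d * B)"
    proof (rule integral_le)
      fix x :: real assume x: "x \<in> {0..1}"
      have "(f x - p x) * f x \<le> \<bar>f x - p x\<bar> * \<bar>f x\<bar>" by (simp flip: abs_mult)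
      also have "\<dots> \<le> d * B" using p(2)[OF x] B[OF x] by (intro mult_mono) auto
      finally show "(f x - p x) * f x \<le> d * B" .
    qed (auto intro!: int continuous_intros cont pc)
    finally show ?thesis using d by simp
  qed
  hence "integral {0..1} (\<lambda>t. f t * f t) \<le> 0" by (rule field_le_epsilon) simp
  moreover have "integral {0..1} (\<lambda>t. f t * f t) \<ge> 0"
    by (intro integral_nonneg int cont) auto
  ultimately have "integral {0..1} (\<lambda>t. f t * f t) = 0" by simp
  moreover have "continuous_on {0..1} (\<lambda>t. f t * f t)"
    using cont by (intro continuous_intros)
  ultimately have "\<forall>x\<in>{0..1}. f x * f x = 0"
    by (subst (asm) integral_eq_0_iff) simp_all
  thus ?thesis using t by simp
qed

section \<open>Moments of Euler's kernel\<close>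

definition beta_kernel :: "complex \<Rightarrow> complex \<Rightarrow> real \<Rightarrow> complex" where
  "beta_kernel b c t = of_real t powr (b - 1) * of_real (1 - t) powr (c - b - 1)"

text \<open>Both exponents have positive real part, so the kernel is continuous up to the endpoints.
  The bound 1, instead of the 0 that convergence requires, thus makes all integrals proper.\<close>

lemma continuous_on_beta_kernel:
  assumes "Re b > 1" "Re (c - b) > 1"
  shows "continuous_on {0..1} (beta_kernel b c)"
  unfolding beta_kernel_def using assms by (intro continuous_intros) auto

text \<open>Integration by parts: t^(b+n) (1-t)^(c-b) vanishes at 0 and 1, and its derivative is the
  difference of the two integrands with their factors.\<close>

lemma beta_kernel_moment_Suc:
  assumes b: "Re b > 1" and cb: "Re (c - b) > 1"
  shows "(c + of_nat n) * integral {0..1} (\<lambda>t. of_real t ^ Suc n * beta_kernel b c t)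
       = (b + of_nat n) * integral {0..1} (\<lambda>t. of_real t ^ n * beta_kernel b c t)"
proof -
  let ?m = "\<lambda>n. integral {0..1} (\<lambda>t. of_real t ^ n * beta_kernel b c t)"
  have int: "(\<lambda>t. of_real t ^ n * beta_kernel b c t) integrable_on {0..1}" for n
    by (intro integrable_continuous_interval continuous_intros continuous_on_beta_kernel assms)
  define F where "F t = of_real t ^ n * (of_real t powr b * of_real (1 - t) powr (c - b))" for t :: real
  define F' where "F' t = (b + of_nat n) * (of_real t ^ n * beta_kernel b c t)
                         - (c + of_nat n) * (of_real t ^ Suc n * beta_kernel b c t)" for t :: real
  have "(F' has_integral (F 1 - F 0)) {0..1}"
  proof (rule fundamental_theorem_of_calculus_interior[where f = F])
    show "continuous_on {0..1} F"
      unfolding F_def using assms by (intro continuous_intros) auto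
  next
    fix t :: real assume t: "t \<in> {0<..<1}"
    have t': "of_real t \<noteq> (0::complex)" "1 - of_real t \<noteq> (0::complex)"
      using t by (auto simp: complex_eq_iff)
    have nr: "of_real t \<notin> (\<real>\<^sub>\<le>\<^sub>0 :: complex set)" "1 - complex_of_real t \<notin> \<real>\<^sub>\<le>\<^sub>0"
      using t by (auto simp: complex_nonpos_Reals_iff)
    let ?z = "complex_of_real t"
    have d1: "((\<lambda>z. z powr b) has_field_derivative b * ?z powr (b - 1)) (at ?z)"
      by (rule has_field_derivative_powr[OF nr(1)])
    have d2: "((\<lambda>z. (1 - z) powr (c - b)) has_field_derivative
                (c - b) * (1 - ?z) powr (c - b - 1) * (- 1)) (at ?z)"
      by (rule DERIV_chain2[where g = "\<lambda>z::complex. 1 - z" and x = ?z,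
            OF has_field_derivative_powr[OF nr(2)]])
         (auto intro!: derivative_eq_intros)
    have p: "?z powr b = ?z * ?z powr (b - 1)"
            "(1 - ?z) powr (c - b) = (1 - ?z) * (1 - ?z) powr (c - b - 1)"
      using t' by (simp_all add: powr_diff)
    \<comment> \<open>For \<open>n = 0\<close> the truncated exponent \<open>n - 1\<close> is
      harmless, since the factor \<open>of_nat n\<close> is zero.\<close>
    have n: "(of_nat n * ?z ^ (n - 1)) * ?z = of_nat n * ?z ^ n"
      by (cases n) auto
    \<comment> \<open>With the powers replaced by variables, the derivative becomes a ring
      identity.\<close>
    have alg: "M * (z * X * ((1 - z) * Y)) + (b * X * ((1 - z) * Y) + (c - b) * Y * (- 1) * (z * X)) * Z
        = (b + N) * (Z * (X * Y)) - (c + N) * (z * Z * (X * Y))"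
      if "M * z = N * Z" for M N X Y Z z :: complex
      using that by algebra
    have "((\<lambda>z. z ^ n * (z powr b * (1 - z) powr (c - b))) has_field_derivative F' t) (at ?z)"
    proof (rule DERIV_cong)
      show "((\<lambda>z. z ^ n * (z powr b * (1 - z) powr (c - b))) has_field_derivative
         (of_nat n * ?z ^ (n - 1)) * (?z powr b * (1 - ?z) powr (c - b))
         + (b * ?z powr (b - 1) * (1 - ?z) powr (c - b)
            + (c - b) * (1 - ?z) powr (c - b - 1) * (- 1) * ?z powr b) * ?z ^ n) (at ?z)"
        using DERIV_mult[OF DERIV_power[OF DERIV_ident, of n] DERIV_mult[OF d1 d2]] by simp
      show "(of_nat n * ?z ^ (n - 1)) * (?z powr b * (1 - ?z) powr (c - b))
         + (b * ?z powr (b - 1) * (1 - ?z) powr (c - b)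
            + (c - b) * (1 - ?z) powr (c - b - 1) * (- 1) * ?z powr b) * ?z ^ n = F' t"
        unfolding F'_def beta_kernel_def p power_Suc of_real_diff of_real_1 by (rule alg[OF n])
    qed
    from has_vector_derivative_real_field[OF this]
    show "(F has_vector_derivative F' t) (at t)"
      by (simp add: F_def[abs_def])
  qed auto
  moreover have "F 1 = 0" "F 0 = 0" by (auto simp: F_def)
  ultimately have "integral {0..1} F' = 0" by (simp add: integral_unique)
  also have "integral {0..1} F' = (b + of_nat n) * ?m n - (c + of_nat n) * ?m (Suc n)"
    unfolding F'_def
    by (subst integral_diff) (auto intro!: integrable_on_mult_right int simp del: power_Suc)
  finally show ?thesis by simp
qed

lemma beta_kernel_moment:
  assumes b: "Re b > 1" and cb: "Re (c - b) > 1"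
  shows "integral {0..1} (\<lambda>t. of_real t ^ n * beta_kernel b c t)
       = pochhammer b n / pochhammer c n * integral {0..1} (beta_kernel b c)"
proof (induction n)
  case (Suc n)
  have "Re (c + of_nat n) > 0" using b cb by simp
  hence nz: "c + of_nat n \<noteq> 0" by (metis zero_complex.sel(1) less_irrefl)
  have "integral {0..1} (\<lambda>t. of_real t ^ Suc n * beta_kernel b c t) =
     (b + of_nat n) / (c + of_nat n) * integral {0..1} (\<lambda>t. of_real t ^ n * beta_kernel b c t)"
    using beta_kernel_moment_Suc[OF assms, of n] nz by (simp add: field_simps del: power_Suc)
  thus ?case unfolding Suc.IH pochhammer_rec' by simp
qed simp

text \<open>If the zeroth moment vanished, so would all the others by
  \<open>beta_kernel_moment\<close>, and then the kernel itself; but both of its bases are nonzero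
  at 1/2.\<close>

lemma integral_beta_kernel_nonzero:
  assumes b: "Re b > 1" and cb: "Re (c - b) > 1"
  shows "integral {0..1} (beta_kernel b c) \<noteq> 0"
proof
  assume "integral {0..1} (beta_kernel b c) = 0"
  hence m: "integral {0..1} (\<lambda>t. of_real t ^ n * beta_kernel b c t) = 0" for n
    by (simp add: beta_kernel_moment[OF assms])
  have int: "(\<lambda>t. of_real t ^ n * beta_kernel b c t) integrable_on {0..1}" for n
    by (intro integrable_continuous_interval continuous_intros continuous_on_beta_kernel assms)
  have *: "((\<lambda>t. of_real t ^ n * beta_kernel b c t) has_integral 0) {0..1}" for n
    using int[of n] m[of n] by (simp add: has_integral_iff)
  have t: "(1/2::real) \<in> {0..1}" by auto
  \<comment> \<open>The moment lemma is about real functions, hence the split into real and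
    imaginary part.\<close>
  have "Re (beta_kernel b c (1/2)) = 0"
  proof (rule moments_eq_0_imp_eq_0[OF _ _ t])
    show "continuous_on {0..1} (\<lambda>t. Re (beta_kernel b c t))"
      by (intro continuous_intros continuous_on_beta_kernel assms)
    show "integral {0..1} (\<lambda>t. t ^ n * Re (beta_kernel b c t)) = 0" for n
      using has_integral_Re[OF *[of n]] by (simp add: integral_unique flip: of_real_power)
  qed
  moreover have "Im (beta_kernel b c (1/2)) = 0"
  proof (rule moments_eq_0_imp_eq_0[OF _ _ t])
    show "continuous_on {0..1} (\<lambda>t. Im (beta_kernel b c t))"
      by (intro continuous_intros continuous_on_beta_kernel assms)
    show "integral {0..1} (\<lambda>t. t ^ n * Im (beta_kernel b c t)) = 0" for n
      using has_integral_Im[OF *[of n]] by (simp add: integral_unique flip: of_real_power)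
  qed
  ultimately have "beta_kernel b c (1/2) = 0" by (simp add: complex_eq_iff)
  thus False by (simp add: beta_kernel_def)
qed

section \<open>Holomorphy of Euler's integral\<close>

lemma one_minus_scale_notin_nonpos_Reals:
  assumes "w \<in> slit_plane" "t \<in> {0..1}"
  shows "1 - of_real t * w \<notin> \<real>\<^sub>\<le>\<^sub>0"
  using scale_in_slit_plane[OF assms(1), of t] assms(2)
  by (auto simp: in_slit_plane_iff complex_nonpos_Reals_iff)

text \<open>Joint continuity for differentiation under the integral sign. The power of
  \<open>t\<close> accommodates the factor \<open>t\<close> that differentiation in \<open>w\<close>
  produces.\<close>

lemma continuous_on_slit_plane_product:
  assumes "Re b > 1" "Re (c - b) > 1" "U \<subseteq> slit_plane"
  shows "continuous_on (U \<times> {0..1})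
    (\<lambda>(w, t). of_real t ^ n * beta_kernel b c t * (1 - of_real t * w) powr s)"
proof -
  have kernel: "continuous_on (U \<times> {0..1}) (\<lambda>x. beta_kernel b c (snd x))"
    by (rule continuous_on_compose2[OF continuous_on_beta_kernel[OF assms(1,2)]])
       (auto intro!: continuous_intros)
  have power: "continuous_on (U \<times> {0..1}) (\<lambda>x. (1 - of_real (snd x) * fst x) powr s)"
  proof (intro continuous_intros)
    have "1 - of_real (snd x) * fst x \<notin> \<real>\<^sub>\<le>\<^sub>0" if "x \<in> U \<times> {0..1}" for x :: "complex \<times> real"
      using that assms(3) by (intro one_minus_scale_notin_nonpos_Reals) auto
    thus "U \<times> {0..1} \<subseteq>
      {x. 0 \<le> Re (1 - of_real (snd x) * fst x) \<or> Im (1 - of_real (snd x) * fst x) \<noteq> 0}"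
      and "\<And>x. x \<in> U \<times> {0..1} \<Longrightarrow> 1 - of_real (snd x) * fst x = 0 \<Longrightarrow> 0 < Re s"
      by (force simp: complex_nonpos_Reals_iff simp del: minus_complex.sel)+
  qed
  show ?thesis
    unfolding case_prod_unfold
    by (intro continuous_on_mult kernel power) (intro continuous_intros)
qed

lemma holomorphic_on_euler_integral:
  assumes b: "Re b > 1" and cb: "Re (c - b) > 1"
  shows "(\<lambda>w. integral {0..1} (\<lambda>t. beta_kernel b c t * (1 - of_real t * w) powr (- a)))
    holomorphic_on slit_plane"
  unfolding holomorphic_on_open[OF open_slit_plane]
proof
  fix w assume "w \<in> slit_plane"
  \<comment> \<open>The Leibniz rule asks for a convex domain, which the slit plane is not; a ball
    around each point suffices.\<close>
  then obtain e where e: "e > 0" "ball w e \<subseteq> slit_plane"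
    using open_slit_plane openE by blast
  have "(\<lambda>w. integral (cbox 0 1) (\<lambda>t. beta_kernel b c t * (1 - of_real t * w) powr (- a)))
    holomorphic_on ball w e"
  proof (rule leibniz_rule_holomorphic)
    fix x :: complex and t :: real assume "x \<in> ball w e" and t: "t \<in> cbox 0 1"
    hence x: "x \<in> slit_plane" using e by auto
    show "((\<lambda>x. beta_kernel b c t * (1 - of_real t * x) powr (- a)) has_field_derivative
        a * (of_real t ^ 1 * beta_kernel b c t * (1 - of_real t * x) powr (- a - 1))) (at x within ball w e)"
      using one_minus_scale_notin_nonpos_Reals[OF x, of t] t
      by (auto intro!: derivative_eq_intros)
  next
    fix x assume "x \<in> ball w e"
    hence x: "x \<in> slit_plane" using e by auto
    show "(\<lambda>t. beta_kernel b c t * (1 - of_real t * x) powr (- a)) integrable_on cbox 0 1"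
      unfolding cbox_interval
    proof (intro integrable_continuous_interval continuous_intros continuous_on_beta_kernel assms)
      show "{0..1} \<subseteq> {t. 0 \<le> Re (1 - of_real t * x) \<or> Im (1 - of_real t * x) \<noteq> 0}"
        using one_minus_scale_notin_nonpos_Reals[OF x]
        by (force simp: complex_nonpos_Reals_iff simp del: minus_complex.sel)
    qed (use one_minus_scale_notin_nonpos_Reals[OF x] in force)
  next
    show "continuous_on (ball w e \<times> cbox 0 1) (\<lambda>(x, t).
       a * (of_real t ^ 1 * beta_kernel b c t * (1 - of_real t * x) powr (- a - 1)))"
      using continuous_on_mult_left[OF continuous_on_slit_plane_product[OF assms e(2), of 1 "- a - 1"], of a]
      by (simp add: case_prod_unfold)
  qed auto
  thus "\<exists>f'. ((\<lambda>w. integral {0..1} (\<lambda>t. beta_kernel b c t * (1 - of_real t * w) powr (- a)))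
            has_field_derivative f') (at w)"
    using e by (auto simp: holomorphic_on_open)
qed

section \<open>Taylor expansion of Euler's integral\<close>

text \<open>The binomial series with exponent \<open>- a\<close>; the signs in
  \<open>(- a) gchoose n\<close> and \<open>(- z) ^ n\<close> cancel.\<close>

lemma binomial_series_pochhammer:
  fixes z a :: complex
  assumes "norm z < 1"
  shows "(\<lambda>n. pochhammer a n / fact n * z ^ n) sums (1 - z) powr (- a)"
proof -
  have "(\<lambda>n. ((- a) gchoose n) * (- z) ^ n) sums (1 + (- z)) powr (- a)"
    by (rule gen_binomial_complex) (use assms in simp)
  also have "(\<lambda>n. ((- a) gchoose n) * (- z) ^ n) = (\<lambda>n. pochhammer a n / fact n * z ^ n)"
    by (simp add: gbinomial_pochhammer power_minus[of z] mult_ac flip: power_add mult_2)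
  finally show ?thesis by simp
qed

text \<open>The power is expanded by the binomial series and integrated term by term. The n-th
  moment of the kernel supplies the missing factor
  \<open>pochhammer b n / pochhammer c n\<close>.\<close>

lemma euler_integral_eq_hypergeo_series:
  assumes b: "Re b > 1" and cb: "Re (c - b) > 1" and w: "norm w < 1"
  shows "integral {0..1} (\<lambda>t. beta_kernel b c t * (1 - of_real t * w) powr (- a))
       = integral {0..1} (beta_kernel b c) * hypergeo_series a b c w"
proof -
  define u where "u n t = pochhammer a n / fact n * (of_real t * w) ^ n * beta_kernel b c t" for n and t :: real
  obtain B where B: "\<And>x. x \<in> {0..1} \<Longrightarrow> norm (beta_kernel b c x) \<le> B"
    using compact_continuous_image[OF continuous_on_beta_kernel[OF b cb]]
    by (metis compact_Icc compact_imp_bounded bounded_iff imageI)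
  have summ: "summable (\<lambda>n. norm (pochhammer a n / fact n) * norm w ^ n * B)"
  proof -
    have "summable (\<lambda>n. norm (pochhammer a n / fact n * w ^ n))"
    proof -
      \<comment> \<open>Convergence at the larger radius \<open>r\<close> gives absolute convergence
        at \<open>w\<close>.\<close>
      obtain r where r: "norm w < r" "r < 1" using w dense by blast
      have "summable (\<lambda>n. pochhammer a n / fact n * of_real r ^ n)"
        using binomial_series_pochhammer[of "of_real r" a] r norm_ge_zero[of w]
        by (simp add: sums_iff)
      thus ?thesis
        by (rule powser_insidea) (use r in auto)
    qed
    thus ?thesis by (intro summable_mult2) (simp add: norm_mult norm_divide norm_power)
  qed
  have unif: "uniform_limit {0..1} (\<lambda>n t. \<Sum>i<n. u i t) (\<lambda>t. \<Sum>i. u i t) sequentially"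
  proof (rule Weierstrass_m_test)
    show "summable (\<lambda>n. norm (pochhammer a n / fact n) * norm w ^ n * B)" by (rule summ)
    fix n and t :: real assume t: "t \<in> {0..1}"
    have "norm (u n t) = norm (pochhammer a n / fact n) * (t ^ n * norm w ^ n) * norm (beta_kernel b c t)"
      using t by (simp add: u_def norm_mult norm_power norm_divide power_mult_distrib)
    also have "\<dots> \<le> norm (pochhammer a n / fact n) * (1 * norm w ^ n) * B"
      using t by (intro mult_mono mult_nonneg_nonneg B power_le_one) auto
    finally show "norm (u n t) \<le> norm (pochhammer a n / fact n) * norm w ^ n * B" by simp
  qed
  have cont: "continuous_on {0..1} (u n)" for n
    unfolding u_def by (intro continuous_intros continuous_on_beta_kernel b cb)
  obtain I J where IJ: "\<And>n. ((\<lambda>t. \<Sum>i<n. u i t) has_integral I n) {0..1}"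
      "((\<lambda>t. \<Sum>i. u i t) has_integral J) {0..1}" "I \<longlonglongrightarrow> J"
    by (rule uniform_limit_integral[OF unif]) (auto intro!: continuous_intros cont)
  have "I = (\<lambda>n. \<Sum>i<n. integral {0..1} (u i))"
  proof
    fix n
    have "I n = integral {0..1} (\<lambda>t. \<Sum>i<n. u i t)" by (rule integral_unique[OF IJ(1), symmetric])
    also have "\<dots> = (\<Sum>i<n. integral {0..1} (u i))"
      by (intro integral_sum integrable_continuous_interval cont) auto
    finally show "I n = (\<Sum>i<n. integral {0..1} (u i))" .
  qed
  with IJ(3) have sums: "(\<lambda>n. integral {0..1} (u n)) sums J" by (simp add: sums_def)
  have u: "integral {0..1} (u n) = integral {0..1} (beta_kernel b c) *
       (pochhammer a n * pochhammer b n / pochhammer c n * (w ^ n / fact n))" for n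
  proof -
    have "integral {0..1} (u n) =
      integral {0..1} (\<lambda>t. pochhammer a n / fact n * w ^ n * (of_real t ^ n * beta_kernel b c t))"
      by (simp add: u_def[abs_def] power_mult_distrib mult_ac)
    also have "\<dots> = pochhammer a n / fact n * w ^ n *
      integral {0..1} (\<lambda>t. of_real t ^ n * beta_kernel b c t)"
      by (rule integral_mult_right)
    also have "\<dots> = integral {0..1} (beta_kernel b c) *
       (pochhammer a n * pochhammer b n / pochhammer c n * (w ^ n / fact n))"
      unfolding beta_kernel_moment[OF b cb] by (simp add: mult_ac)
    finally show ?thesis .
  qed
  \<comment> \<open>\<open>sums_mult_D\<close> divides by the integral of the kernel, which is
    nonzero.\<close>
  have "J = integral {0..1} (beta_kernel b c) * hypergeo_series a b c w"
    using sums_unique[OF sums_mult_D[OF sums[unfolded u] integral_beta_kernel_nonzero[OF b cb]]]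
      integral_beta_kernel_nonzero[OF b cb]
    by (simp add: hypergeo_series_def field_simps)
  moreover have "(\<Sum>i. u i t) = beta_kernel b c t * (1 - of_real t * w) powr (- a)" if "t \<in> {0..1}" for t
  proof -
    have "norm (of_real t * w) < 1"
      using that w by (auto simp: norm_mult intro: order.strict_trans1[OF mult_left_le_one_le])
    from sums_mult2[OF binomial_series_pochhammer[OF this, of a], of "beta_kernel b c t"]
    show ?thesis by (simp add: u_def sums_iff mult_ac)
  qed
  hence "integral {0..1} (\<lambda>t. \<Sum>i. u i t) =
    integral {0..1} (\<lambda>t. beta_kernel b c t * (1 - of_real t * w) powr (- a))"
    by (intro integral_cong)
  ultimately show ?thesis using IJ(2) by (simp add: integral_unique)
qed

lemma hypergeo_continuation_exists_large:
  assumes b: "Re b > 1" and cb: "Re (c - b) > 1"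
  shows "\<exists>f. is_hypergeo_continuation a b c f"
proof
  let ?f = "\<lambda>w. integral {0..1} (\<lambda>t. beta_kernel b c t * (1 - of_real t * w) powr (- a))
                / integral {0..1} (beta_kernel b c)"
  show "is_hypergeo_continuation a b c ?f"
    unfolding is_hypergeo_continuation_def
    using integral_beta_kernel_nonzero[OF b cb]
    by (auto intro!: holomorphic_intros holomorphic_on_euler_integral b cb
             simp: euler_integral_eq_hypergeo_series[OF b cb])
qed

section \<open>Descent to all parameters\<close>

lemma hypergeo_series_commute: "hypergeo_series a b c = hypergeo_series b a c"
  by (simp add: hypergeo_series_def fun_eq_iff mult_ac)

lemma hypergeo_continuation_c_minus:
  assumes "c \<notin> \<int>\<^sub>\<le>\<^sub>0" "\<exists>f. is_hypergeo_continuation a b (c + 1) f"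
  shows "\<exists>f. is_hypergeo_continuation a b c f"
proof -
  obtain f where f: "is_hypergeo_continuation a b (c + 1) f" using assms by blast
  have "c + 1 - 1 \<noteq> 0" "c + 1 - 1 \<notin> \<int>\<^sub>\<le>\<^sub>0" using assms by auto
  from hypergeo_continuation_lower[OF f this(1) hypergeo_series_c_minus[OF this(2)]]
  show ?thesis by simp
qed

lemma hypergeo_continuation_b_c_minus:
  assumes "c \<notin> \<int>\<^sub>\<le>\<^sub>0" "\<exists>f. is_hypergeo_continuation a (b + 1) (c + 1) f"
  shows "\<exists>f. is_hypergeo_continuation a b c f"
proof -
  obtain f where f: "is_hypergeo_continuation (b + 1) a (c + 1) f"
    using assms by (auto simp: is_hypergeo_continuation_def hypergeo_series_commute)
  have "c + 1 - 1 \<noteq> 0" "c + 1 - 1 \<notin> \<int>\<^sub>\<le>\<^sub>0" using assms by auto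
  from hypergeo_continuation_lower[OF f this(1) hypergeo_series_a_c_minus[OF this(2)]]
  have "\<exists>g. is_hypergeo_continuation b a c g" by simp
  thus ?thesis by (simp add: is_hypergeo_continuation_def hypergeo_series_commute[of a b])
qed

text \<open>\<open>b\<close> and \<open>c\<close> are raised together, which fixes
  \<open>c - b\<close>, and then \<open>c\<close> alone, until Euler's integral applies; the shifts
  are undone in the opposite order. Adding naturals keeps \<open>c\<close> out of the nonpositive
  integers, so each lowering step divides by a nonzero number.\<close>

lemma hypergeo_continuation_exists:
  assumes "c \<notin> \<int>\<^sub>\<le>\<^sub>0"
  shows "\<exists>f. is_hypergeo_continuation a b c f"
proof -
  have c_shift: "(\<exists>f. is_hypergeo_continuation a b c f)"
    if "c \<notin> \<int>\<^sub>\<le>\<^sub>0" "\<exists>f. is_hypergeo_continuation a b (c + of_nat m) f" for b c m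
    using that
  proof (induction m arbitrary: c)
    case (Suc m)
    have "\<exists>f. is_hypergeo_continuation a b (c + 1) f"
      using Suc.prems by - (rule Suc.IH[OF notin_nonpos_Ints_plus1], simp_all add: add_ac)
    with Suc.prems(1) show ?case by (rule hypergeo_continuation_c_minus)
  qed simp
  have b_c_shift: "(\<exists>f. is_hypergeo_continuation a b c f)"
    if "c \<notin> \<int>\<^sub>\<le>\<^sub>0" "\<exists>f. is_hypergeo_continuation a (b + of_nat n) (c + of_nat n) f" for b c n
    using that
  proof (induction n arbitrary: b c)
    case (Suc n)
    have "\<exists>f. is_hypergeo_continuation a (b + 1) (c + 1) f"
      using Suc.prems by - (rule Suc.IH[OF notin_nonpos_Ints_plus1], simp_all add: add_ac)
    with Suc.prems(1) show ?case by (rule hypergeo_continuation_b_c_minus)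
  qed simp
  obtain n :: nat where n: "real n > 1 - Re b" using reals_Archimedean2 by blast
  obtain m :: nat where m: "real m > 1 - Re (c - b)" using reals_Archimedean2 by blast
  have "\<exists>f. is_hypergeo_continuation a (b + of_nat n) (c + of_nat n + of_nat m) f"
    using n m by (intro hypergeo_continuation_exists_large) auto
  moreover have "c + of_nat n \<notin> \<int>\<^sub>\<le>\<^sub>0"
    using assms by (induction n) (auto dest: notin_nonpos_Ints_plus1 simp: add_ac)
  ultimately have "\<exists>f. is_hypergeo_continuation a (b + of_nat n) (c + of_nat n) f"
    by (rule c_shift[rotated])
  with assms show ?thesis by (rule b_c_shift)
qed

text \<open>Existence is what turns the choice in \<open>hypergeo_F\<close> into a genuine
  continuation.\<close>

lemma is_hypergeo_continuation_hypergeo_F: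
  assumes "c \<notin> \<int>\<^sub>\<le>\<^sub>0"
  shows "is_hypergeo_continuation a b c (hypergeo_F a b c)"
  using someI_ex[OF hypergeo_continuation_exists[OF assms, of a b]]
  unfolding is_hypergeo_continuation_def hypergeo_F_def .

lemma hypergeo_F_commute: "hypergeo_F a b c = hypergeo_F b a c"
  by (simp add: hypergeo_F_def hypergeo_series_commute)

section \<open>Recurrences for the normalized function\<close>

text \<open>The Beta function B(b, c - b). It does not involve \<open>a\<close>, so shifts of
  \<open>a\<close> and of \<open>b\<close> lead to different constants.\<close>

definition euler_factor :: "complex \<Rightarrow> complex \<Rightarrow> complex" where
  "euler_factor b c = Gamma b * Gamma (c - b) / Gamma c"

definition normalized_F :: "complex \<Rightarrow> complex \<Rightarrow> complex \<Rightarrow> complex \<Rightarrow> complex" where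
  "normalized_F a b c w = euler_factor b c * hypergeo_F a b c w"

lemma FI_eq_normalized_F:
  "FI \<alpha> \<beta> \<mu> = normalized_F ((1 + \<alpha> + \<beta> + \<mu>) / 2) ((1 + \<alpha> + \<beta> - \<mu>) / 2) (1 + \<alpha>)"
proof -
  have "1 + \<alpha> - (1 + \<alpha> + \<beta> - \<mu>) / 2 = (1 + \<alpha> - \<beta> + \<mu>) / 2" by (simp add: field_simps)
  thus ?thesis
    by (intro ext) (simp only: FI_def normalized_F_def euler_factor_def add.commute[of \<alpha> 1])
qed

lemma Gamma_plus1_minus1:
  fixes z :: complex
  assumes "z \<notin> \<int>"
  shows "Gamma (z + 1) = z * Gamma z" "Gamma (z - 1) = Gamma z / (z - 1)"
proof -
  have z: "z \<notin> \<int>\<^sub>\<le>\<^sub>0" "z - 1 \<notin> \<int>\<^sub>\<le>\<^sub>0" "z - 1 \<noteq> 0"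
    using assms Ints_add[OF _ Ints_1, of "z - 1"] nonpos_Ints_Int by auto
  show "Gamma (z + 1) = z * Gamma z" by (rule Gamma_plus1[OF z(1)])
  show "Gamma (z - 1) = Gamma z / (z - 1)"
    using Gamma_plus1[OF z(2)] z(3) by (simp add: field_simps)
qed

context
  fixes a b c :: complex
  assumes b: "b \<notin> \<int>" and c: "c \<notin> \<int>" and cb: "c - b \<notin> \<int>"
begin

lemma generic_nonzero:
  "b \<noteq> 0" "b - 1 \<noteq> 0" "c \<noteq> 0" "c - 1 \<noteq> 0" "c - b \<noteq> 0" "c - b - 1 \<noteq> 0" "Gamma c \<noteq> 0"
  \<comment> \<open>In HOL, \<open>Gamma\<close> has the value 0 at its poles and nowhere else, so
    \<open>Gamma c\<close> is nonzero because \<open>c\<close> is not an integer.\<close>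
  using b c cb by (auto simp: Gamma_eq_zero_iff)

lemma generic_c_notin_nonpos_Ints:
  "c \<notin> \<int>\<^sub>\<le>\<^sub>0" "c + 1 \<notin> \<int>\<^sub>\<le>\<^sub>0" "c - 1 \<notin> \<int>\<^sub>\<le>\<^sub>0"
proof -
  have "c - 1 \<notin> \<int>" using c Ints_add[OF _ Ints_1, of "c - 1"] by auto
  thus "c \<notin> \<int>\<^sub>\<le>\<^sub>0" "c + 1 \<notin> \<int>\<^sub>\<le>\<^sub>0" "c - 1 \<notin> \<int>\<^sub>\<le>\<^sub>0"
    using c notin_nonpos_Ints_plus1 nonpos_Ints_Int by auto
qed

text \<open>Each shift moves exactly two of \<open>b\<close>, \<open>c\<close>, \<open>c - b\<close>
  by 1, so the functional equation of Gamma is applied twice.\<close>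

lemma euler_factor_shift:
  "euler_factor (b + 1) (c + 1) = b / c * euler_factor b c"
  "euler_factor (b - 1) (c - 1) = (c - 1) / (b - 1) * euler_factor b c"
  "euler_factor b (c + 1) = (c - b) / c * euler_factor b c"
  "euler_factor b (c - 1) = (c - 1) / (c - b - 1) * euler_factor b c"
  "euler_factor (b + 1) c = b / (c - b - 1) * euler_factor b c"
  "euler_factor (b - 1) c = (c - b) / (b - 1) * euler_factor b c"
proof -
  have arg: "c + 1 - (b + 1) = c - b" "c - 1 - (b - 1) = c - b" "c + 1 - b = (c - b) + 1"
    "c - 1 - b = (c - b) - 1" "c - (b + 1) = (c - b) - 1" "c - (b - 1) = (c - b) + 1"
    by simp_all
  note [simp] = Gamma_plus1_minus1[OF b] Gamma_plus1_minus1[OF c] Gamma_plus1_minus1[OF cb]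
  show "euler_factor (b + 1) (c + 1) = b / c * euler_factor b c"
    "euler_factor (b - 1) (c - 1) = (c - 1) / (b - 1) * euler_factor b c"
    "euler_factor b (c + 1) = (c - b) / c * euler_factor b c"
    "euler_factor b (c - 1) = (c - 1) / (c - b - 1) * euler_factor b c"
    "euler_factor (b + 1) c = b / (c - b - 1) * euler_factor b c"
    "euler_factor (b - 1) c = (c - b) / (b - 1) * euler_factor b c"
    unfolding euler_factor_def arg by simp_all
qed

lemma deriv_normalized_F:
  assumes "w \<in> slit_plane"
  shows "deriv (normalized_F a b c) w = euler_factor b c * deriv (hypergeo_F a b c) w"
proof -
  have "hypergeo_F a b c field_differentiable at w"
    using is_hypergeo_continuation_hypergeo_F[OF generic_c_notin_nonpos_Ints(1)] assms open_slit_plane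
    unfolding is_hypergeo_continuation_def by (blast intro: holomorphic_on_imp_differentiable_at)
  thus ?thesis by (simp add: normalized_F_def[abs_def] deriv_cmult)
qed

lemmas hypergeo_F_relation = hypergeo_relation_continuation
  [OF is_hypergeo_continuation_hypergeo_F is_hypergeo_continuation_hypergeo_F]

section \<open>The twelve relations in the parameters a, b, c\<close>

context
  fixes w :: complex
  assumes w: "w \<in> slit_plane"
begin

text \<open>The pattern for all twelve: the series relation, carried to the slit plane, is
  multiplied by \<open>euler_factor b c\<close>. Here the shift of this factor absorbs
  \<open>b / c\<close> from the constant \<open>a * b / c\<close>.\<close>

lemma normalized_F_a_b_c_plus:
  "deriv (normalized_F a b c) w
     = a * normalized_F (a + 1) (b + 1) (c + 1) w"
proof -
  note rel = hypergeo_F_relation[OF generic_c_notin_nonpos_Ints(1) generic_c_notin_nonpos_Ints(2)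
      hypergeo_series_a_b_c_plus[OF generic_c_notin_nonpos_Ints(1)] w, of a b]
  show ?thesis
    using rel generic_nonzero
    unfolding normalized_F_def deriv_normalized_F[OF w] euler_factor_shift
    by (simp add: divide_simps)
qed

lemma normalized_F_a_b_c_minus:
  "- (w * (1 - w) * deriv (normalized_F a b c) w + ((c - 1) * (1 - w) - (a + b - c) * w) * normalized_F a b c w)
     = (1 - b) * normalized_F (a - 1) (b - 1) (c - 1) w"
proof -
  note rel = hypergeo_F_relation[OF generic_c_notin_nonpos_Ints(1) generic_c_notin_nonpos_Ints(3)
      hypergeo_series_a_b_c_minus[OF generic_c_notin_nonpos_Ints(3)] w, of a b]
  show ?thesis
    using rel generic_nonzero
    unfolding normalized_F_def deriv_normalized_F[OF w] euler_factor_shift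
    by (simp add: divide_simps) algebra
qed

lemma normalized_F_c_plus:
  "(1 - w) * deriv (normalized_F a b c) w - (a + b - c) * normalized_F a b c w
     = (c - a) * normalized_F a b (c + 1) w"
proof -
  note rel = hypergeo_F_relation[OF generic_c_notin_nonpos_Ints(1) generic_c_notin_nonpos_Ints(2)
      hypergeo_series_c_plus[OF generic_c_notin_nonpos_Ints(1)] w, of a b]
  show ?thesis
    using rel generic_nonzero
    unfolding normalized_F_def deriv_normalized_F[OF w] euler_factor_shift
    by (simp add: divide_simps) algebra
qed

text \<open>The constant \<open>c - 1\<close> is \<open>c - b - 1\<close> times the shift of
  \<open>euler_factor\<close>; the change of sign makes it \<open>1 - c + b\<close>.\<close>

lemma normalized_F_c_minus:
  "- (w * deriv (normalized_F a b c) w + (c - 1) * normalized_F a b c w)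
     = (1 - c + b) * normalized_F a b (c - 1) w"
proof -
  note rel = hypergeo_F_relation[OF generic_c_notin_nonpos_Ints(1) generic_c_notin_nonpos_Ints(3)
      hypergeo_series_c_minus[OF generic_c_notin_nonpos_Ints(3)] w, of a b]
  show ?thesis
    using rel generic_nonzero
    unfolding normalized_F_def deriv_normalized_F[OF w] euler_factor_shift
    by (simp add: divide_simps) algebra
qed

lemma normalized_F_a_plus:
  "w * deriv (normalized_F a b c) w + a * normalized_F a b c w
     = a * normalized_F (a + 1) b c w"
proof -
  note rel = hypergeo_F_relation[OF generic_c_notin_nonpos_Ints(1) generic_c_notin_nonpos_Ints(1)
      hypergeo_series_a_plus[OF generic_c_notin_nonpos_Ints(1)] w, of a b]
  show ?thesis
    using rel generic_nonzero
    unfolding normalized_F_def deriv_normalized_F[OF w] euler_factor_shift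
    by (simp add: divide_simps) algebra
qed

lemma normalized_F_a_minus:
  "- (w * (w - 1) * deriv (normalized_F a b c) w + (a + b - c + b * (w - 1)) * normalized_F a b c w)
     = (c - a) * normalized_F (a - 1) b c w"
proof -
  note rel = hypergeo_F_relation[OF generic_c_notin_nonpos_Ints(1) generic_c_notin_nonpos_Ints(1)
      hypergeo_series_a_minus[OF generic_c_notin_nonpos_Ints(1)] w, of a b]
  show ?thesis
    using rel generic_nonzero
    unfolding normalized_F_def deriv_normalized_F[OF w] euler_factor_shift
    by (simp add: divide_simps) algebra
qed

lemma normalized_F_b_plus:
  "- (w * deriv (normalized_F a b c) w + b * normalized_F a b c w)
     = (1 - c + b) * normalized_F a (b + 1) c w"
proof -
  \<comment> \<open>The relation for the first parameter, taken with \<open>a\<close> and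
    \<open>b\<close> exchanged. The instances of \<open>hypergeo_F_commute\<close> have a fixed
    first argument, so that rewriting puts \<open>a\<close> back in front.\<close>
  note rel = hypergeo_F_relation[OF generic_c_notin_nonpos_Ints(1) generic_c_notin_nonpos_Ints(1)
      hypergeo_series_a_plus[OF generic_c_notin_nonpos_Ints(1)] w, of b a]
  show ?thesis
    using rel generic_nonzero
    unfolding normalized_F_def deriv_normalized_F[OF w] euler_factor_shift
      hypergeo_F_commute[of b] hypergeo_F_commute[of "b + 1"] hypergeo_F_commute[of "b - 1"]
    by (simp add: divide_simps) algebra
qed

lemma normalized_F_b_minus:
  "w * (w - 1) * deriv (normalized_F a b c) w + (a + b - c + a * (w - 1)) * normalized_F a b c w
     = (1 - b) * normalized_F a (b - 1) c w"
proof -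
  note rel = hypergeo_F_relation[OF generic_c_notin_nonpos_Ints(1) generic_c_notin_nonpos_Ints(1)
      hypergeo_series_a_minus[OF generic_c_notin_nonpos_Ints(1)] w, of b a]
  show ?thesis
    using rel generic_nonzero
    unfolding normalized_F_def deriv_normalized_F[OF w] euler_factor_shift
      hypergeo_F_commute[of b] hypergeo_F_commute[of "b + 1"] hypergeo_F_commute[of "b - 1"]
    by (simp add: divide_simps) algebra
qed

lemma normalized_F_a_c_plus:
  "(w - 1) * deriv (normalized_F a b c) w + a * normalized_F a b c w
     = a * normalized_F (a + 1) b (c + 1) w"
proof -
  note rel = hypergeo_F_relation[OF generic_c_notin_nonpos_Ints(1) generic_c_notin_nonpos_Ints(2)
      hypergeo_series_a_c_plus[OF generic_c_notin_nonpos_Ints(1)] w, of a b]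
  show ?thesis
    using rel generic_nonzero
    unfolding normalized_F_def deriv_normalized_F[OF w] euler_factor_shift
    by (simp add: divide_simps) algebra
qed

lemma normalized_F_a_c_minus:
  "w * (w - 1) * deriv (normalized_F a b c) w + (- (c - 1) + b * w) * normalized_F a b c w
     = (1 - c + b) * normalized_F (a - 1) b (c - 1) w"
proof -
  note rel = hypergeo_F_relation[OF generic_c_notin_nonpos_Ints(1) generic_c_notin_nonpos_Ints(3)
      hypergeo_series_a_c_minus[OF generic_c_notin_nonpos_Ints(3)] w, of a b]
  show ?thesis
    using rel generic_nonzero
    unfolding normalized_F_def deriv_normalized_F[OF w] euler_factor_shift
    by (simp add: divide_simps) algebra
qed

lemma normalized_F_b_c_plus:
  "(w - 1) * deriv (normalized_F a b c) w + b * normalized_F a b c w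
     = (c - a) * normalized_F a (b + 1) (c + 1) w"
proof -
  note rel = hypergeo_F_relation[OF generic_c_notin_nonpos_Ints(1) generic_c_notin_nonpos_Ints(2)
      hypergeo_series_a_c_plus[OF generic_c_notin_nonpos_Ints(1)] w, of b a]
  show ?thesis
    using rel generic_nonzero
    unfolding normalized_F_def deriv_normalized_F[OF w] euler_factor_shift
      hypergeo_F_commute[of b] hypergeo_F_commute[of "b + 1"] hypergeo_F_commute[of "b - 1"]
    by (simp add: divide_simps) algebra
qed

lemma normalized_F_b_c_minus:
  "w * (w - 1) * deriv (normalized_F a b c) w + (- (c - 1) + a * w) * normalized_F a b c w
     = (1 - b) * normalized_F a (b - 1) (c - 1) w"
proof -
  note rel = hypergeo_F_relation[OF generic_c_notin_nonpos_Ints(1) generic_c_notin_nonpos_Ints(3)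
      hypergeo_series_a_c_minus[OF generic_c_notin_nonpos_Ints(3)] w, of b a]
  show ?thesis
    using rel generic_nonzero
    unfolding normalized_F_def deriv_normalized_F[OF w] euler_factor_shift
      hypergeo_F_commute[of b] hypergeo_F_commute[of "b + 1"] hypergeo_F_commute[of "b - 1"]
    by (simp add: divide_simps) algebra
qed

end

end


theorem mainTheorem2:
  fixes \<alpha> \<beta> \<mu> w :: complex
  assumes "generic \<alpha> \<beta> \<mu>" and "w \<in> slit_plane"
  shows
    "deriv (FI \<alpha> \<beta> \<mu>) w
       = (1 + \<alpha> + \<beta> + \<mu>) / 2 * FI (\<alpha> + 1) (\<beta> + 1) \<mu> w
   \<and> - (w * (1 - w) * deriv (FI \<alpha> \<beta> \<mu>) w + (\<alpha> * (1 - w) - \<beta> * w) * FI \<alpha> \<beta> \<mu> w)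
       = (1 - \<alpha> - \<beta> + \<mu>) / 2 * FI (\<alpha> - 1) (\<beta> - 1) \<mu> w
   \<and> (1 - w) * deriv (FI \<alpha> \<beta> \<mu>) w - \<beta> * FI \<alpha> \<beta> \<mu> w
       = (1 + \<alpha> - \<beta> - \<mu>) / 2 * FI (\<alpha> + 1) (\<beta> - 1) \<mu> w
   \<and> - (w * deriv (FI \<alpha> \<beta> \<mu>) w + \<alpha> * FI \<alpha> \<beta> \<mu> w)
       = (1 - \<alpha> + \<beta> - \<mu>) / 2 * FI (\<alpha> - 1) (\<beta> + 1) \<mu> w
   \<and> w * deriv (FI \<alpha> \<beta> \<mu>) w + (1 + \<alpha> + \<beta> + \<mu>) / 2 * FI \<alpha> \<beta> \<mu> w
       = (1 + \<alpha> + \<beta> + \<mu>) / 2 * FI \<alpha> (\<beta> + 1) (\<mu> + 1) w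
   \<and> - (w * (w - 1) * deriv (FI \<alpha> \<beta> \<mu>) w
         + (\<beta> + (1 + \<alpha> + \<beta> - \<mu>) / 2 * (w - 1)) * FI \<alpha> \<beta> \<mu> w)
       = (1 + \<alpha> - \<beta> - \<mu>) / 2 * FI \<alpha> (\<beta> - 1) (\<mu> - 1) w
   \<and> - (w * deriv (FI \<alpha> \<beta> \<mu>) w + (1 + \<alpha> + \<beta> - \<mu>) / 2 * FI \<alpha> \<beta> \<mu> w)
       = (1 - \<alpha> + \<beta> - \<mu>) / 2 * FI \<alpha> (\<beta> + 1) (\<mu> - 1) w
   \<and> w * (w - 1) * deriv (FI \<alpha> \<beta> \<mu>) w
         + (\<beta> + (1 + \<alpha> + \<beta> + \<mu>) / 2 * (w - 1)) * FI \<alpha> \<beta> \<mu> w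
       = (1 - \<alpha> - \<beta> + \<mu>) / 2 * FI \<alpha> (\<beta> - 1) (\<mu> + 1) w
   \<and> (w - 1) * deriv (FI \<alpha> \<beta> \<mu>) w + (1 + \<alpha> + \<beta> + \<mu>) / 2 * FI \<alpha> \<beta> \<mu> w
       = (1 + \<alpha> + \<beta> + \<mu>) / 2 * FI (\<alpha> + 1) \<beta> (\<mu> + 1) w
   \<and> w * (w - 1) * deriv (FI \<alpha> \<beta> \<mu>) w
         + (- \<alpha> + (1 + \<alpha> + \<beta> - \<mu>) / 2 * w) * FI \<alpha> \<beta> \<mu> w
       = (1 - \<alpha> + \<beta> - \<mu>) / 2 * FI (\<alpha> - 1) \<beta> (\<mu> - 1) w
   \<and> (w - 1) * deriv (FI \<alpha> \<beta> \<mu>) w + (1 + \<alpha> + \<beta> - \<mu>) / 2 * FI \<alpha> \<beta> \<mu> w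
       = (1 + \<alpha> - \<beta> - \<mu>) / 2 * FI (\<alpha> + 1) \<beta> (\<mu> - 1) w
   \<and> w * (w - 1) * deriv (FI \<alpha> \<beta> \<mu>) w
         + (- \<alpha> + (1 + \<alpha> + \<beta> + \<mu>) / 2 * w) * FI \<alpha> \<beta> \<mu> w
       = (1 - \<alpha> - \<beta> + \<mu>) / 2 * FI (\<alpha> - 1) \<beta> (\<mu> + 1) w"
proof -
  \<comment> \<open>In these coordinates every shift of the three original parameters adds -1, 0 or
    1 to each of \<open>a\<close>, \<open>b\<close>, \<open>c\<close>, and \<open>generic\<close>
    says that \<open>c - 1\<close>, \<open>b\<close> and \<open>c - b\<close> are not
    integers.\<close>
  define a b c where "a = (1 + \<alpha> + \<beta> + \<mu>) / 2" and "b = (1 + \<alpha> + \<beta> - \<mu>) / 2" and "c = 1 + \<alpha>"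
  have params: "\<alpha> = c - 1" "\<beta> = a + b - c" "\<mu> = a - b"
    by (simp_all add: a_def b_def c_def field_simps)
  have cZ: "c \<notin> \<int>"
    using assms(1) Ints_diff[OF _ Ints_1, of c] by (auto simp: generic_def c_def)
  have cb: "c - b = (1 + \<alpha> - \<beta> + \<mu>) / 2" by (simp add: b_def c_def field_simps)
  have bZ: "b \<notin> \<int>" "c - b \<notin> \<int>"
    unfolding cb using assms(1) by (simp_all add: generic_def b_def)
  have FI: "FI \<alpha> \<beta> \<mu> = normalized_F a b c"
    by (simp add: FI_eq_normalized_F a_def b_def c_def)
  have FI_shift: "FI x y z = normalized_F a' b' c'"
    if "1 + x + y + z = 2 * a'" "1 + x + y - z = 2 * b'" "1 + x = c'" for x y z a' b' c'
    using that by (simp add: FI_eq_normalized_F)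
  have shifts:
    "FI (\<alpha> + 1) (\<beta> + 1) \<mu> = normalized_F (a + 1) (b + 1) (c + 1)"
    "FI (\<alpha> - 1) (\<beta> - 1) \<mu> = normalized_F (a - 1) (b - 1) (c - 1)"
    "FI (\<alpha> + 1) (\<beta> - 1) \<mu> = normalized_F a b (c + 1)"
    "FI (\<alpha> - 1) (\<beta> + 1) \<mu> = normalized_F a b (c - 1)"
    "FI \<alpha> (\<beta> + 1) (\<mu> + 1) = normalized_F (a + 1) b c"
    "FI \<alpha> (\<beta> - 1) (\<mu> - 1) = normalized_F (a - 1) b c"
    "FI \<alpha> (\<beta> + 1) (\<mu> - 1) = normalized_F a (b + 1) c"
    "FI \<alpha> (\<beta> - 1) (\<mu> + 1) = normalized_F a (b - 1) c"
    "FI (\<alpha> + 1) \<beta> (\<mu> + 1) = normalized_F (a + 1) b (c + 1)"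
    "FI (\<alpha> - 1) \<beta> (\<mu> - 1) = normalized_F (a - 1) b (c - 1)"
    "FI (\<alpha> + 1) \<beta> (\<mu> - 1) = normalized_F a (b + 1) (c + 1)"
    "FI (\<alpha> - 1) \<beta> (\<mu> + 1) = normalized_F a (b - 1) (c - 1)"
    by (intro FI_shift; simp add: params algebra_simps)+
  have coeffs: "(1 + \<alpha> + \<beta> + \<mu>) / 2 = a" "(1 + \<alpha> + \<beta> - \<mu>) / 2 = b"
    "(1 - \<alpha> - \<beta> + \<mu>) / 2 = 1 - b" "(1 + \<alpha> - \<beta> - \<mu>) / 2 = c - a"
    "(1 - \<alpha> + \<beta> - \<mu>) / 2 = 1 - c + b"
    by (simp_all add: a_def b_def c_def field_simps)
  show ?thesis
    \<comment> \<open>The original parameters are eliminated last, because \<open>shifts\<close> and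
      \<open>coeffs\<close> match terms written in them.\<close>
    unfolding shifts FI coeffs unfolding params(1,2)
    by (intro conjI normalized_F_a_b_c_plus normalized_F_a_b_c_minus normalized_F_c_plus normalized_F_c_minus
      normalized_F_a_plus normalized_F_a_minus normalized_F_b_plus normalized_F_b_minus
      normalized_F_a_c_plus normalized_F_a_c_minus normalized_F_b_c_plus normalized_F_b_c_minus
      bZ cZ assms(2))
qed

end
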